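(* Let $\Psi=\Psi(s,t)$ be a solution of the Betchov-Da Rios equation $\Psi_t=\Psi_s\times\Psi_{ss}\times\Psi_{sss}$ in $E^4$ (with unit speed $s$-parameter curves), with its parallel transport frame field. The soliton surface $\Psi=\Psi(s,t)$ is semi-umbilic if and only if, at every point, $(Q\mathcal{W})^2=\mathcal{A}$ or $\mathcal{C}=0$ holds.
   Context: Setting. $E^4$ is $\mathbb{R}^4$ with its standard inner product $\langle\cdot,\cdot\rangle$ and orientation; the ternary vector product $x\times y\times z$ is the formal determinant of the $4\times4$ matrix whose first row is the standard basis $(e_1,e_2,e_3,e_4)$ and whose remaining rows are $x,y,z$. Subscripts $s,t$ denote partial derivatives. $\Psi=\Psi(s,t)$ is a smooth map from a product of two open intervals to $E^4$ whose $s$-parameter curves $s\mapsto\Psi(s,t)$ are unit speed for all $t$. A parallel transport frame field is a smooth positively oriented orthonormal frame $\{\mathcal{T},\mathcal{P}_1,\mathcal{P}_2,\mathcal{P}_3\}$ along $\Psi$ with $\mathcal{T}=\Psi_s$, $\mathcal{T}_s=k_1\mathcal{P}_1+k_2\mathcal{P}_2+k_3\mathcal{P}_3$ and $(\mathcal{P}_i)_s=-k_i\mathcal{T}$; $k_1,k_2,k_3$ are its curvature functions. Put $\mathfrak{a}_{23}=\langle(\mathcal{P}_1)_t,\mathcal{P}_2\rangle$, $\mathfrak{a}_{24}=\langle(\mathcal{P}_1)_t,\mathcal{P}_3\rangle$, $\mathfrak{a}_{34}=\langle(\mathcal{P}_2)_t,\mathcal{P}_3\rangle$, $P=k_3(k_2)_s-k_2(k_3)_s$,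 $R=k_1(k_3)_s-k_3(k_1)_s$, $S=k_2(k_1)_s-k_1(k_2)_s$, $Q=\sqrt{k_1^2+k_2^2+k_3^2}$, $\mathcal{W}=\sqrt{P^2+R^2+S^2}$, and $\mathcal{A}=(Pk_3-Sk_1)\mathfrak{a}_{24}+(Pk_2-Rk_1)\mathfrak{a}_{23}+(Rk_3-Sk_2)\mathfrak{a}_{34}-R(k_2)_t-S(k_3)_t-P(k_1)_t$, $\mathcal{C}=(k_1)_sP_s+(k_2)_sR_s+(k_3)_sS_s$. Standing assumptions: at least two of $k_1,k_2,k_3$ are non-zero, and $P,R,S$ are not all zero at any point. Semi-umbilic surfaces. Let $g_{11}=\langle\Psi_s,\Psi_s\rangle$, $g_{12}=\langle\Psi_s,\Psi_t\rangle$, $g_{22}=\langle\Psi_t,\Psi_t\rangle$ (so that $\mathcal{W}=\sqrt{g_{11}g_{22}-g_{12}^2}$). The orthonormal normal frame used is $N_1=\frac{1}{Q}(k_1\mathcal{P}_1+k_2\mathcal{P}_2+k_3\mathcal{P}_3)$, $N_2=\frac{1}{Q\mathcal{W}}\big((k_2S-k_3R)\mathcal{P}_1+(k_3P-k_1S)\mathcal{P}_2+(k_1R-k_2P)\mathcal{P}_3\big)$. Let $c_{11}^i=\langle\Psi_{ss},N_i\rangle$, $c_{12}^i=\langle\Psi_{st},N_i\rangle$, $c_{22}^i=\langle\Psi_{tt},N_i\rangle$. The Gaussian torsion is $$K_N=\frac{g_{11}(c_{12}^1c_{22}^2-c_{12}^2c_{22}^1)-g_{12}(c_{11}^1c_{22}^2-c_{11}^2c_{22}^1)+g_{22}(c_{11}^1c_{12}^2-c_{11}^2c_{12}^1)}{\mathcal{W}^3}.$$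 A point $p$ is semi-umbilic iff $K_N(p)=0$, and a surface is semi-umbilic if all its points are. *)

theory Defs
  imports "HOL-Analysis.Analysis"
begin

type_synonym scalar_map = "real \<times> real \<Rightarrow> real"

type_synonym vector_map = "real \<times> real \<Rightarrow> real^4"

text \<open>On an open set \<open>D\<close> of a finite-dimensional space, \<open>C_k_on n D\<close> is the class of \<open>n\<close> times
  continuously differentiable maps.\<close>

primrec C_k_on :: "nat \<Rightarrow> 'a::real_normed_vector set \<Rightarrow> ('a \<Rightarrow> 'b::real_normed_vector) \<Rightarrow> bool" where
  "C_k_on 0 D f \<longleftrightarrow> continuous_on D f"
| "C_k_on (Suc n) D f \<longleftrightarrow>
     (\<forall>x\<in>D. f differentiable (at x)) \<and> (\<forall>v. C_k_on n D (\<lambda>x. frechet_derivative f (at x) v))"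

definition smooth_map_on :: "'a::real_normed_vector set \<Rightarrow> ('a \<Rightarrow> 'b::real_normed_vector) \<Rightarrow> bool" where
  "smooth_map_on D f \<longleftrightarrow> (\<forall>n. C_k_on n D f)"

text \<open>Points of the parameter domain are pairs \<open>(s, t)\<close>; a repeated subscript is read from left
  to right, so that for example \<open>f\<^sub>s\<^sub>t\<close> is \<open>pd_t (pd_s f)\<close>.\<close>

definition pd_s :: "(real \<times> real \<Rightarrow> 'b::real_normed_vector) \<Rightarrow> real \<times> real \<Rightarrow> 'b" where
  "pd_s f p = vector_derivative (\<lambda>s. f (s, snd p)) (at (fst p))"

definition pd_t :: "(real \<times> real \<Rightarrow> 'b::real_normed_vector) \<Rightarrow> real \<times> real \<Rightarrow> 'b" where
  "pd_t f p = vector_derivative (\<lambda>t. f (fst p, t)) (at (snd p))"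

text \<open>The determinant is linear in its first row, so the \<open>i\<close>-th component of the formal determinant
  whose first row is the standard basis is the determinant with first row \<open>axis i 1\<close>.\<close>

definition ternary_product :: "real^4 \<Rightarrow> real^4 \<Rightarrow> real^4 \<Rightarrow> real^4" where
  "ternary_product x y z = (\<chi> i. det (vector [axis i 1, x, y, z] :: real^4^4))"

definition betchov_da_rios :: "(real \<times> real) set \<Rightarrow> vector_map \<Rightarrow> bool" where
  "betchov_da_rios D \<Psi> \<longleftrightarrow>
     (\<forall>p\<in>D. pd_t \<Psi> p = ternary_product (pd_s \<Psi> p) (pd_s (pd_s \<Psi>) p) (pd_s (pd_s (pd_s \<Psi>)) p))"

definition pos_orthonormal_frame :: "real^4 \<Rightarrow> real^4 \<Rightarrow> real^4 \<Rightarrow> real^4 \<Rightarrow> bool" where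
  "pos_orthonormal_frame x y z w \<longleftrightarrow>
     x \<bullet> x = 1 \<and> y \<bullet> y = 1 \<and> z \<bullet> z = 1 \<and> w \<bullet> w = 1 \<and>
     x \<bullet> y = 0 \<and> x \<bullet> z = 0 \<and> x \<bullet> w = 0 \<and> y \<bullet> z = 0 \<and> y \<bullet> w = 0 \<and> z \<bullet> w = 0 \<and>
     det (vector [x, y, z, w] :: real^4^4) > 0"

definition parallel_transport_frame ::
  "(real \<times> real) set \<Rightarrow> vector_map \<Rightarrow>
   vector_map \<Rightarrow> vector_map \<Rightarrow> vector_map \<Rightarrow> vector_map \<Rightarrow>
   scalar_map \<Rightarrow> scalar_map \<Rightarrow> scalar_map \<Rightarrow> bool" where
  "parallel_transport_frame D \<Psi> T P1 P2 P3 k1 k2 k3 \<longleftrightarrow>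
     smooth_map_on D T \<and> smooth_map_on D P1 \<and> smooth_map_on D P2 \<and> smooth_map_on D P3 \<and>
     (\<forall>p\<in>D.
        pos_orthonormal_frame (T p) (P1 p) (P2 p) (P3 p) \<and>
        T p = pd_s \<Psi> p \<and>
        pd_s T p = k1 p *\<^sub>R P1 p + k2 p *\<^sub>R P2 p + k3 p *\<^sub>R P3 p \<and>
        pd_s P1 p = - (k1 p *\<^sub>R T p) \<and>
        pd_s P2 p = - (k2 p *\<^sub>R T p) \<and>
        pd_s P3 p = - (k3 p *\<^sub>R T p))"

definition curv_P :: "scalar_map \<Rightarrow> scalar_map \<Rightarrow> scalar_map \<Rightarrow> scalar_map" where
  "curv_P k1 k2 k3 p = k3 p * pd_s k2 p - k2 p * pd_s k3 p"

definition curv_R :: "scalar_map \<Rightarrow> scalar_map \<Rightarrow> scalar_map \<Rightarrow> scalar_map" where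
  "curv_R k1 k2 k3 p = k1 p * pd_s k3 p - k3 p * pd_s k1 p"

definition curv_S :: "scalar_map \<Rightarrow> scalar_map \<Rightarrow> scalar_map \<Rightarrow> scalar_map" where
  "curv_S k1 k2 k3 p = k2 p * pd_s k1 p - k1 p * pd_s k2 p"

definition curv_Q :: "scalar_map \<Rightarrow> scalar_map \<Rightarrow> scalar_map \<Rightarrow> scalar_map" where
  "curv_Q k1 k2 k3 p = sqrt ((k1 p)\<^sup>2 + (k2 p)\<^sup>2 + (k3 p)\<^sup>2)"

definition curv_W :: "scalar_map \<Rightarrow> scalar_map \<Rightarrow> scalar_map \<Rightarrow> scalar_map" where
  "curv_W k1 k2 k3 p = sqrt ((curv_P k1 k2 k3 p)\<^sup>2 + (curv_R k1 k2 k3 p)\<^sup>2 + (curv_S k1 k2 k3 p)\<^sup>2)"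

definition curv_C :: "scalar_map \<Rightarrow> scalar_map \<Rightarrow> scalar_map \<Rightarrow> scalar_map" where
  "curv_C k1 k2 k3 p =
     pd_s k1 p * pd_s (curv_P k1 k2 k3) p + pd_s k2 p * pd_s (curv_R k1 k2 k3) p
     + pd_s k3 p * pd_s (curv_S k1 k2 k3) p"

definition curv_A ::
  "vector_map \<Rightarrow> vector_map \<Rightarrow> vector_map \<Rightarrow>
   scalar_map \<Rightarrow> scalar_map \<Rightarrow> scalar_map \<Rightarrow> scalar_map" where
  "curv_A P1 P2 P3 k1 k2 k3 p =
     (let P = curv_P k1 k2 k3 p; R = curv_R k1 k2 k3 p; S = curv_S k1 k2 k3 p;
          a23 = pd_t P1 p \<bullet> P2 p; a24 = pd_t P1 p \<bullet> P3 p; a34 = pd_t P2 p \<bullet> P3 p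
      in (P * k3 p - S * k1 p) * a24 + (P * k2 p - R * k1 p) * a23 + (R * k3 p - S * k2 p) * a34
         - R * pd_t k2 p - S * pd_t k3 p - P * pd_t k1 p)"

definition normal_N1 ::
  "vector_map \<Rightarrow> vector_map \<Rightarrow> vector_map \<Rightarrow>
   scalar_map \<Rightarrow> scalar_map \<Rightarrow> scalar_map \<Rightarrow> vector_map" where
  "normal_N1 P1 P2 P3 k1 k2 k3 p =
     (1 / curv_Q k1 k2 k3 p) *\<^sub>R (k1 p *\<^sub>R P1 p + k2 p *\<^sub>R P2 p + k3 p *\<^sub>R P3 p)"

definition normal_N2 ::
  "vector_map \<Rightarrow> vector_map \<Rightarrow> vector_map \<Rightarrow>
   scalar_map \<Rightarrow> scalar_map \<Rightarrow> scalar_map \<Rightarrow> vector_map" where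
  "normal_N2 P1 P2 P3 k1 k2 k3 p =
     (let P = curv_P k1 k2 k3 p; R = curv_R k1 k2 k3 p; S = curv_S k1 k2 k3 p
      in (1 / (curv_Q k1 k2 k3 p * curv_W k1 k2 k3 p)) *\<^sub>R
           ((k2 p * S - k3 p * R) *\<^sub>R P1 p + (k3 p * P - k1 p * S) *\<^sub>R P2 p
            + (k1 p * R - k2 p * P) *\<^sub>R P3 p))"

text \<open>The denominator is the cube of the area element \<open>sqrt (g11 * g22 - g12\<^sup>2)\<close> of the surface,
  which for the surfaces considered here equals \<open>curv_W\<close>.\<close>

definition gaussian_torsion ::
  "vector_map \<Rightarrow> vector_map \<Rightarrow> vector_map \<Rightarrow> scalar_map" where
  "gaussian_torsion \<Psi> N1 N2 p =
     (let g11 = pd_s \<Psi> p \<bullet> pd_s \<Psi> p; g12 = pd_s \<Psi> p \<bullet> pd_t \<Psi> p; g22 = pd_t \<Psi> p \<bullet> pd_t \<Psi> p;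
          c11 = (\<lambda>N. pd_s (pd_s \<Psi>) p \<bullet> N p);
          c12 = (\<lambda>N. pd_t (pd_s \<Psi>) p \<bullet> N p);
          c22 = (\<lambda>N. pd_t (pd_t \<Psi>) p \<bullet> N p)
      in (g11 * (c12 N1 * c22 N2 - c12 N2 * c22 N1)
          - g12 * (c11 N1 * c22 N2 - c11 N2 * c22 N1)
          + g22 * (c11 N1 * c12 N2 - c11 N2 * c12 N1))
         / (sqrt (g11 * g22 - g12\<^sup>2)) ^ 3)"

definition semi_umbilic ::
  "(real \<times> real) set \<Rightarrow> vector_map \<Rightarrow> vector_map \<Rightarrow> vector_map \<Rightarrow> bool" where
  "semi_umbilic D \<Psi> N1 N2 \<longleftrightarrow> (\<forall>p\<in>D. gaussian_torsion \<Psi> N1 N2 p = 0)"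

end

theory Submission
  imports Defs
begin

text \<open>Write \<open>k = (k1, k2, k3)\<close> and \<open>n = (P, R, S)\<close> in the coordinates given by \<open>P1, P2, P3\<close>. Then
  \<open>n = - (k \<times> k\<^sub>s)\<close>, and the Betchov-Da Rios equation says \<open>\<Psi>\<^sub>t = P P1 + R P2 + S P3\<close>, so that
  \<open>g11 = 1\<close>, \<open>g12 = 0\<close> and \<open>g22 = W\<^sup>2\<close>. Differentiating \<open>\<langle>k, n\<rangle> = 0\<close>, using \<open>\<Psi>\<^sub>s\<^sub>t = \<Psi>\<^sub>t\<^sub>s\<close> and
  \<open>k \<times> n = Q\<^sup>2 k\<^sub>s - \<langle>k, k\<^sub>s\<rangle> k\<close>, the second fundamental form satisfies \<open>c11 = (Q, 0)\<close>,
  \<open>c12 = (0, Q C / W)\<close> and \<open>c22 = (A / Q, _)\<close>. Hence the Gaussian torsion is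
  \<open>C ((Q W)\<^sup>2 - A) / W\<^sup>4\<close>.\<close>

subsection \<open>Smooth maps and partial derivatives\<close>

text \<open>As \<open>D\<close> is open, \<open>f\<close> and \<open>g\<close> agree near each point
  of \<open>D\<close>, so their Frechet derivatives agree on \<open>D\<close> and the induction
  continues. This permits replacing a derivative by a formula that is valid on \<open>D\<close>
  only.\<close>

lemma C_k_on_cong:
  assumes "open D" "\<And>x. x \<in> D \<Longrightarrow> f x = g x" "C_k_on n D f"
  shows "C_k_on n D g"
  using assms(2,3)
proof (induction n arbitrary: f g)
  case 0
  then show ?case by (simp cong: continuous_on_cong_simp)
next
  case (Suc n)
  have "g differentiable at x" if "x \<in> D" for x
    using Suc.prems that assms(1)
    by (simp add: differentiable_def) (metis has_derivative_transform_within_open)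
  moreover have "C_k_on n D (\<lambda>x. frechet_derivative g (at x) v)" for v
  proof (rule Suc.IH)
    show "C_k_on n D (\<lambda>x. frechet_derivative f (at x) v)" using Suc.prems by simp
    show "frechet_derivative f (at x) v = frechet_derivative g (at x) v" if "x \<in> D" for x
      using frechet_derivative_transform_within_open[of f x D g] Suc.prems that assms(1) by simp
  qed
  ultimately show ?case by simp
qed

text \<open>The only content is at the bottom, where differentiability gives continuity; higher up
  the claim is passed on to the directional derivatives.\<close>

lemma C_k_on_SucD: "C_k_on (Suc n) D f \<Longrightarrow> C_k_on n D f"
proof (induction n arbitrary: f)
  case 0
  then show ?case
    by (auto intro!: continuous_at_imp_continuous_on differentiable_imp_continuous_within)
next
  case (Suc n)
  then show ?case by (metis C_k_on.simps(2))
qed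

lemma C_k_on_add:
  assumes "open D" "C_k_on n D f" "C_k_on n D g"
  shows "C_k_on n D (\<lambda>x. f x + g x)"
  using assms(2,3)
proof (induction n arbitrary: f g)
  case 0
  then show ?case by (simp add: continuous_on_add)
next
  case (Suc n)
  have "C_k_on n D (\<lambda>x. frechet_derivative (\<lambda>x. f x + g x) (at x) v)" for v
  proof (rule C_k_on_cong[OF assms(1)])
    show "C_k_on n D (\<lambda>x. frechet_derivative f (at x) v + frechet_derivative g (at x) v)"
      using Suc by simp
    show "frechet_derivative f (at x) v + frechet_derivative g (at x) v
            = frechet_derivative (\<lambda>x. f x + g x) (at x) v" if "x \<in> D" for x
      using Suc.prems that
      by (subst frechet_derivative_at[symmetric, OF has_derivative_add])
        (auto simp: frechet_derivative_works)
  qed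
  then show ?case using Suc.prems by simp
qed

text \<open>By the product rule, the derivative is a sum of two inner products in which one factor
  is undifferentiated. That factor is lowered by \<open>C_k_on_SucD\<close> before the induction
  hypothesis applies.\<close>

lemma C_k_on_inner:
  fixes f g :: "'a::real_normed_vector \<Rightarrow> 'b::real_inner"
  assumes "open D" "C_k_on n D f" "C_k_on n D g"
  shows "C_k_on n D (\<lambda>x. f x \<bullet> g x)"
  using assms(2,3)
proof (induction n arbitrary: f g)
  case 0
  then show ?case by (simp add: continuous_on_inner)
next
  case (Suc n)
  have D: "((\<lambda>x. f x \<bullet> g x) has_derivative
      (\<lambda>v. f x \<bullet> frechet_derivative g (at x) v + frechet_derivative f (at x) v \<bullet> g x)) (at x)"
    if "x \<in> D" for x
    using Suc.prems that by (intro has_derivative_inner) (auto simp: frechet_derivative_works)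
  have "C_k_on n D (\<lambda>x. frechet_derivative (\<lambda>x. f x \<bullet> g x) (at x) v)" for v
  proof (rule C_k_on_cong[OF assms(1)])
    show "C_k_on n D
        (\<lambda>x. f x \<bullet> frechet_derivative g (at x) v + frechet_derivative f (at x) v \<bullet> g x)"
      using Suc.prems Suc.prems[THEN C_k_on_SucD] by (intro C_k_on_add[OF assms(1)] Suc.IH) simp_all
    show "f x \<bullet> frechet_derivative g (at x) v + frechet_derivative f (at x) v \<bullet> g x
            = frechet_derivative (\<lambda>x. f x \<bullet> g x) (at x) v" if "x \<in> D" for x
      by (simp add: frechet_derivative_at[symmetric, OF D[OF that]])
  qed
  then show ?case using D by (auto simp: differentiable_def)
qed

lemma C_k_on_const: "C_k_on n D (\<lambda>x. c)"
  by (induction n arbitrary: c) auto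

lemma smooth_map_on_cong:
  assumes "open D" "\<And>x. x \<in> D \<Longrightarrow> f x = g x" "smooth_map_on D f"
  shows "smooth_map_on D g"
  using assms C_k_on_cong unfolding smooth_map_on_def by blast

lemma smooth_map_on_imp_differentiable:
  "smooth_map_on D f \<Longrightarrow> p \<in> D \<Longrightarrow> f differentiable (at p)"
  unfolding smooth_map_on_def by (metis C_k_on.simps(2))

lemma smooth_map_on_imp_continuous_on: "smooth_map_on D f \<Longrightarrow> continuous_on D f"
  unfolding smooth_map_on_def by (metis C_k_on.simps(1))

lemma smooth_map_on_inner:
  "open D \<Longrightarrow> smooth_map_on D f \<Longrightarrow> smooth_map_on D g \<Longrightarrow> smooth_map_on D (\<lambda>x. f x \<bullet> g x)"
  unfolding smooth_map_on_def using C_k_on_inner by blast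

lemma smooth_map_on_mult:
  fixes f g :: "'a::real_normed_vector \<Rightarrow> real"
  shows "open D \<Longrightarrow> smooth_map_on D f \<Longrightarrow> smooth_map_on D g \<Longrightarrow> smooth_map_on D (\<lambda>x. f x * g x)"
  using smooth_map_on_inner[of D f g] by simp

lemma smooth_map_on_diff:
  fixes f g :: "'a::real_normed_vector \<Rightarrow> real"
  assumes "open D" "smooth_map_on D f" "smooth_map_on D g"
  shows "smooth_map_on D (\<lambda>x. f x - g x)"
proof -
  have "smooth_map_on D (\<lambda>x. - 1 * g x)"
    using assms by (intro smooth_map_on_mult) (auto simp: smooth_map_on_def C_k_on_const)
  then have "smooth_map_on D (\<lambda>x. f x + - 1 * g x)"
    using assms C_k_on_add unfolding smooth_map_on_def by blast
  then show ?thesis by simp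
qed

section \<open>Partial derivatives as values of the Frechet derivative\<close>

lemma has_derivative_imp_has_vector_derivative_slices:
  fixes f :: "real \<times> real \<Rightarrow> 'b::real_normed_vector"
  assumes "(f has_derivative f') (at p)"
  shows "((\<lambda>s. f (s, snd p)) has_vector_derivative f' (1, 0)) (at (fst p))"
    and "((\<lambda>t. f (fst p, t)) has_vector_derivative f' (0, 1)) (at (snd p))"
proof -
  have f: "(f has_derivative f') (at (fst p, snd p))" using assms by simp
  interpret bounded_linear f' using assms by (rule has_derivative_bounded_linear)
  have l: "f' (h, 0) = h *\<^sub>R f' (1, 0)" "f' (0, h) = h *\<^sub>R f' (0, 1)" for h
    using scaleR[of h "(1, 0)"] scaleR[of h "(0, 1)"] by simp_all
  have "((\<lambda>s. f (s, snd p)) has_derivative (\<lambda>h. f' (h, 0))) (at (fst p))"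
    using has_derivative_compose[of "\<lambda>s. (s, snd p)" "\<lambda>h. (h, 0)" "fst p" UNIV f f'] f
    by (simp add: has_derivative_Pair)
  then show "((\<lambda>s. f (s, snd p)) has_vector_derivative f' (1, 0)) (at (fst p))"
    by (simp only: has_vector_derivative_def l(1)[symmetric])
  have "((\<lambda>t. f (fst p, t)) has_derivative (\<lambda>h. f' (0, h))) (at (snd p))"
    using has_derivative_compose[of "\<lambda>t. (fst p, t)" "\<lambda>h. (0, h)" "snd p" UNIV f f'] f
    by (simp add: has_derivative_Pair)
  then show "((\<lambda>t. f (fst p, t)) has_vector_derivative f' (0, 1)) (at (snd p))"
    by (simp only: has_vector_derivative_def l(2)[symmetric])
qed

lemma pd_eqI:
  assumes "(f has_derivative f') (at p)"
  shows "pd_s f p = f' (1, 0)" "pd_t f p = f' (0, 1)"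
  using has_derivative_imp_has_vector_derivative_slices[OF assms]
  by (simp_all add: pd_s_def pd_t_def vector_derivative_at)

lemma has_vector_derivative_pd:
  assumes "f differentiable (at p)"
  shows "((\<lambda>s. f (s, snd p)) has_vector_derivative pd_s f p) (at (fst p))"
    and "((\<lambda>t. f (fst p, t)) has_vector_derivative pd_t f p) (at (snd p))"
  using assms has_derivative_imp_has_vector_derivative_slices pd_eqI
  unfolding differentiable_def by metis+

text \<open>A linear map on the plane is determined by its values at \<open>(1, 0)\<close> and
  \<open>(0, 1)\<close>. In this form the library's rules for \<open>has_derivative\<close> turn
  into rules for \<open>pd_s\<close> and \<open>pd_t\<close> through \<open>pd_eqI\<close>.\<close>

lemma has_derivative_pd:
  assumes "f differentiable (at p)"
  shows "(f has_derivative (\<lambda>v. fst v *\<^sub>R pd_s f p + snd v *\<^sub>R pd_t f p)) (at p)"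
proof -
  have f: "(f has_derivative frechet_derivative f (at p)) (at p)"
    using assms by (simp add: frechet_derivative_works)
  interpret bounded_linear "frechet_derivative f (at p)"
    using f by (rule has_derivative_bounded_linear)
  have "frechet_derivative f (at p) = (\<lambda>v. fst v *\<^sub>R pd_s f p + snd v *\<^sub>R pd_t f p)"
  proof
    fix v :: "real \<times> real"
    have "frechet_derivative f (at p) (fst v *\<^sub>R (1, 0) + snd v *\<^sub>R (0, 1))
        = fst v *\<^sub>R pd_s f p + snd v *\<^sub>R pd_t f p"
      by (simp only: add scaleR pd_eqI[OF f])
    then show "frechet_derivative f (at p) v = fst v *\<^sub>R pd_s f p + snd v *\<^sub>R pd_t f p"
      by simp
  qed
  with f show ?thesis by simp
qed

lemma pd_cong:
  assumes "open D" "p \<in> D" "\<And>q. q \<in> D \<Longrightarrow> f q = g q" "f differentiable (at p)"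
  shows "pd_s f p = pd_s g p" "pd_t f p = pd_t g p"
proof -
  note f = has_derivative_pd[OF assms(4)]
  have "(g has_derivative (\<lambda>v. fst v *\<^sub>R pd_s f p + snd v *\<^sub>R pd_t f p)) (at p)"
    using has_derivative_transform_within_open[OF f assms(1-3)] .
  from pd_eqI[OF this] show "pd_s f p = pd_s g p" "pd_t f p = pd_t g p" by simp_all
qed

text \<open>On \<open>D\<close> each partial derivative is the Frechet derivative in a fixed
  direction, whose smoothness is built into the recursion of \<open>C_k_on\<close>.\<close>

lemma smooth_map_on_pd:
  assumes "open D" "smooth_map_on D f"
  shows "smooth_map_on D (pd_s f)" "smooth_map_on D (pd_t f)"
proof -
  have f: "(f has_derivative frechet_derivative f (at p)) (at p)" if "p \<in> D" for p
    using assms smooth_map_on_imp_differentiable that frechet_derivative_works by blast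
  have F: "smooth_map_on D (\<lambda>p. frechet_derivative f (at p) v)" for v
    using assms(2) unfolding smooth_map_on_def by (metis C_k_on.simps(2))
  show "smooth_map_on D (pd_s f)"
    by (rule smooth_map_on_cong[OF assms(1) _ F[of "(1, 0)"]]) (simp add: pd_eqI[OF f])
  show "smooth_map_on D (pd_t f)"
    by (rule smooth_map_on_cong[OF assms(1) _ F[of "(0, 1)"]]) (simp add: pd_eqI[OF f])
qed

subsection \<open>Symmetry of mixed partial derivatives\<close>

text \<open>The mean value theorem is used twice: in \<open>x\<close> for the increment
  \<open>f x (b+k) - f x b\<close>, then in \<open>y\<close> for \<open>fx x\<close> at the point
  \<open>x\<close> just found.\<close>

lemma second_difference_mvt:
  fixes f fx fxy :: "real \<Rightarrow> real \<Rightarrow> real"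
  assumes "0 < h" "0 < k"
    and fx: "\<And>x y. x \<in> {a..a+h} \<Longrightarrow> y \<in> {b..b+k} \<Longrightarrow>
      ((\<lambda>x. f x y) has_real_derivative fx x y) (at x)"
    and fxy: "\<And>x y. x \<in> {a..a+h} \<Longrightarrow> y \<in> {b..b+k} \<Longrightarrow>
      ((\<lambda>y. fx x y) has_real_derivative fxy x y) (at y)"
  obtains x y where "x \<in> {a..a+h}" "y \<in> {b..b+k}"
    "f (a+h) (b+k) - f (a+h) b - f a (b+k) + f a b = h * k * fxy x y"
proof -
  obtain x where x: "a < x" "x < a + h"
    "(f (a+h) (b+k) - f (a+h) b) - (f a (b+k) - f a b) = (a + h - a) * (fx x (b+k) - fx x b)"
  proof -
    have "((\<lambda>x. f x (b+k) - f x b) has_real_derivative fx x (b+k) - fx x b) (at x)"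
      if "a \<le> x" "x \<le> a + h" for x
      using that assms(1,2) by (intro DERIV_diff fx) auto
    then show thesis
      using that MVT2[of a "a+h" "\<lambda>x. f x (b+k) - f x b" "\<lambda>x. fx x (b+k) - fx x b"] assms(1)
      by auto
  qed
  obtain y where y: "b < y" "y < b + k" "fx x (b+k) - fx x b = (b + k - b) * fxy x y"
    using MVT2[of b "b+k" "fx x" "fxy x"] assms(2) fxy[of x] x by auto
  show thesis using x y by (intro that[of x y]) auto
qed

text \<open>Schwarz's theorem: one second difference over a small rectangle is \<open>h * k\<close>
  times a value of \<open>fxy\<close> and also \<open>h * k\<close> times a value of
  \<open>fyx\<close>. Both values are close to those at \<open>(a, b)\<close> by continuity.\<close>

lemma mixed_derivatives_eq:
  fixes f fx fy fxy fyx :: "real \<Rightarrow> real \<Rightarrow> real"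
  assumes "open D" "(a, b) \<in> D"
    and fx: "\<And>x y. (x, y) \<in> D \<Longrightarrow> ((\<lambda>x. f x y) has_real_derivative fx x y) (at x)"
    and fxy: "\<And>x y. (x, y) \<in> D \<Longrightarrow> ((\<lambda>y. fx x y) has_real_derivative fxy x y) (at y)"
    and fy: "\<And>x y. (x, y) \<in> D \<Longrightarrow> ((\<lambda>y. f x y) has_real_derivative fy x y) (at y)"
    and fyx: "\<And>x y. (x, y) \<in> D \<Longrightarrow> ((\<lambda>x. fy x y) has_real_derivative fyx x y) (at x)"
    and "continuous_on D (\<lambda>p. fxy (fst p) (snd p))" "continuous_on D (\<lambda>p. fyx (fst p) (snd p))"
  shows "fxy a b = fyx a b"
proof (rule ccontr)
  \<comment> \<open>Half the supposed gap: two errors below \<open>e\<close> cannot bridge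
    it.\<close>
  define e where "e = \<bar>fxy a b - fyx a b\<bar> / 2"
  assume "fxy a b \<noteq> fyx a b"
  then have "e > 0" by (simp add: e_def)
  have "\<forall>\<^sub>F p in nhds (a, b). p \<in> D \<and> dist (fxy (fst p) (snd p)) (fxy a b) < e
      \<and> dist (fyx (fst p) (snd p)) (fyx a b) < e"
  proof -
    have "isCont (\<lambda>p. fxy (fst p) (snd p)) (a, b)" "isCont (\<lambda>p. fyx (fst p) (snd p)) (a, b)"
      using assms continuous_on_eq_continuous_at by blast+
    then have "((\<lambda>p. fxy (fst p) (snd p)) \<longlongrightarrow> fxy a b) (nhds (a, b))"
      "((\<lambda>p. fyx (fst p) (snd p)) \<longlongrightarrow> fyx a b) (nhds (a, b))"
      by (simp_all add: continuous_at tendsto_nhds_iff)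
    then show ?thesis
      using \<open>e > 0\<close> assms(1,2) by (intro eventually_conj eventually_nhds_in_open tendstoD)
  qed
  then obtain N where N: "open N" "(a, b) \<in> N" "\<And>p. p \<in> N \<Longrightarrow> p \<in> D
      \<and> dist (fxy (fst p) (snd p)) (fxy a b) < e \<and> dist (fyx (fst p) (snd p)) (fyx a b) < e"
    unfolding eventually_nhds by blast
  obtain U V where U_V: "open U" "open V" "(a, b) \<in> U \<times> V" "U \<times> V \<subseteq> N"
    using open_prod_elim[OF N(1,2)] by metis
  then have UV: "open U" "a \<in> U" "open V" "b \<in> V"
    by auto
  have *: "(x, y) \<in> D \<and> dist (fxy x y) (fxy a b) < e \<and> dist (fyx x y) (fyx a b) < e"
    if "x \<in> U" "y \<in> V" for x y
    using N(3)[of "(x, y)"] U_V(4) that by auto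
  have "{a..a+h} \<subseteq> cball a h" for h :: real by (auto simp: dist_real_def)
  then obtain h where h: "h > 0" "{a..a+h} \<subseteq> U"
    using UV open_contains_cball[of U] by (meson order_trans)
  have "{b..b+k} \<subseteq> cball b k" for k :: real by (auto simp: dist_real_def)
  then obtain k where k: "k > 0" "{b..b+k} \<subseteq> V"
    using UV open_contains_cball[of V] by (meson order_trans)
  have hk: "(x, y) \<in> D" if "x \<in> {a..a+h}" "y \<in> {b..b+k}" for x y
    using that h k * by blast
  let ?d = "f (a+h) (b+k) - f (a+h) b - f a (b+k) + f a b"
  obtain x y where xy: "x \<in> {a..a+h}" "y \<in> {b..b+k}" "?d = h * k * fxy x y"
    by (rule second_difference_mvt[of h k a b f fx fxy]) (use h k hk fx fxy in blast)+
  \<comment> \<open>The same lemma with the two variables exchanged. Its second difference is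
    \<open>?d\<close> with the middle terms swapped.\<close>
  obtain y' x' where yx: "y' \<in> {b..b+k}" "x' \<in> {a..a+h}"
      "f (a+h) (b+k) - f a (b+k) - f (a+h) b + f a b = k * h * fyx x' y'"
    by (rule second_difference_mvt[of k h b a "\<lambda>y x. f x y" "\<lambda>y x. fy x y" "\<lambda>y x. fyx x y"])
      (use h k hk fy fyx in blast)+
  have "h * k * fxy x y = h * k * fyx x' y'"
    using xy(3) yx(3) unfolding mult.commute[of k h] by linarith
  then have "fxy x y = fyx x' y'" using h k by simp
  moreover have "dist (fxy x y) (fxy a b) < e" "dist (fyx x' y') (fyx a b) < e"
    using * xy yx h k by blast+
  ultimately have "\<bar>fxy a b - fyx a b\<bar> < 2 * e" unfolding dist_real_def by linarith
  then show False by (simp add: e_def)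
qed

text \<open>Reduction to the scalar case: the real functions \<open>f \<bullet> v\<close> satisfy
  Schwarz's theorem, and a vector is determined by its inner products with all
  \<open>v\<close>.\<close>

lemma pd_t_pd_s_eq_pd_s_pd_t:
  fixes f :: "real \<times> real \<Rightarrow> 'b::real_inner"
  assumes "open D" "smooth_map_on D f" "p \<in> D"
  shows "pd_t (pd_s f) p = pd_s (pd_t f) p"
proof -
  note S = smooth_map_on_pd[OF assms(1)]
  note d = has_vector_derivative_pd[OF smooth_map_on_imp_differentiable]
  have inner: "((\<lambda>x. g x \<bullet> v) has_real_derivative g' \<bullet> v) (at x)"
    if "(g has_vector_derivative g') (at x)" for g g' x and v :: 'b
    using bounded_linear.has_vector_derivative[OF bounded_linear_inner_left that]
    by (simp add: has_real_derivative_iff_has_vector_derivative)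
  have "pd_t (pd_s f) p \<bullet> v = pd_s (pd_t f) p \<bullet> v" for v
  proof -
    note i = d[of D _ "(x, y)" for x y, THEN inner, simplified]
    have "pd_t (pd_s f) (fst p, snd p) \<bullet> v = pd_s (pd_t f) (fst p, snd p) \<bullet> v"
      by (rule mixed_derivatives_eq[of D "fst p" "snd p" "\<lambda>x y. f (x, y) \<bullet> v"
            "\<lambda>x y. pd_s f (x, y) \<bullet> v" "\<lambda>x y. pd_t (pd_s f) (x, y) \<bullet> v"
            "\<lambda>x y. pd_t f (x, y) \<bullet> v" "\<lambda>x y. pd_s (pd_t f) (x, y) \<bullet> v"])
        (simp_all add: assms i S smooth_map_on_imp_continuous_on continuous_on_inner)
    then show ?thesis by simp
  qed
  then show ?thesis by (metis vector_eq_rdot)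
qed

subsection \<open>Orthonormal frames and the ternary product\<close>

lemma vector_4 [simp]:
  "(vector [x, y, z, w] :: 'a::zero^4) $ 1 = x"
  "(vector [x, y, z, w] :: 'a::zero^4) $ 2 = y"
  "(vector [x, y, z, w] :: 'a::zero^4) $ 3 = z"
  "(vector [x, y, z, w] :: 'a::zero^4) $ 4 = w"
  unfolding vector_def by simp_all

text \<open>Laplace expansion along the first row, obtained by splitting off the indices 1, 2, 3 in
  turn from the sum over permutations.\<close>

lemma det_4:
  "det (A::'a::comm_ring_1^4^4) =
    A$1$1 * (A$2$2 * (A$3$3 * A$4$4 - A$3$4 * A$4$3) - A$2$3 * (A$3$2 * A$4$4 - A$3$4 * A$4$2)
      + A$2$4 * (A$3$2 * A$4$3 - A$3$3 * A$4$2))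
    - A$1$2 * (A$2$1 * (A$3$3 * A$4$4 - A$3$4 * A$4$3) - A$2$3 * (A$3$1 * A$4$4 - A$3$4 * A$4$1)
      + A$2$4 * (A$3$1 * A$4$3 - A$3$3 * A$4$1))
    + A$1$3 * (A$2$1 * (A$3$2 * A$4$4 - A$3$4 * A$4$2) - A$2$2 * (A$3$1 * A$4$4 - A$3$4 * A$4$1)
      + A$2$4 * (A$3$1 * A$4$2 - A$3$2 * A$4$1))
    - A$1$4 * (A$2$1 * (A$3$2 * A$4$3 - A$3$3 * A$4$2) - A$2$2 * (A$3$1 * A$4$3 - A$3$3 * A$4$1)
      + A$2$3 * (A$3$1 * A$4$2 - A$3$2 * A$4$1))"
proof -
  have f1: "finite {2::4, 3, 4}" "1 \<notin> {2::4, 3, 4}" by auto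
  have f2: "finite {3::4, 4}" "2 \<notin> {3::4, 4}" by auto
  have f3: "finite {4::4}" "3 \<notin> {4::4}" by auto
  show ?thesis
    unfolding det_def UNIV_4
    unfolding sum_over_permutations_insert[OF f1]
    unfolding sum_over_permutations_insert[OF f2]
    unfolding sum_over_permutations_insert[OF f3]
    unfolding permutes_sing
    by (simp add: sign_swap_id permutation_swap_id permutation_compose sign_compose sign_id
        swap_id_eq)
      (simp add: algebra_simps)
qed

text \<open>Linearity of the determinant in its first row. This describes the product by its
  pairings, so it can be computed in any frame.\<close>

lemma inner_ternary_product:
  "q \<bullet> ternary_product x y z = det (vector [q, x, y, z] :: real^4^4)"
  by (simp add: ternary_product_def inner_vec_def sum_4 det_4 axis_def algebra_simps)

lemma matrix_vector_mult_vector_4: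
  "(vector [x, y, z, w] :: real^4^4) *v v = vector [x \<bullet> v, y \<bullet> v, z \<bullet> v, w \<bullet> v]"
  by (simp add: vec_eq_iff forall_4 matrix_vector_mult_def inner_vec_def)

text \<open>\<open>?M ** transpose ?M\<close> is the Gram matrix of the frame. Orthogonality leaves
  the determinants 1 and -1, and positive orientation selects 1.\<close>

lemma orthogonal_matrix_frame:
  assumes "pos_orthonormal_frame x y z w"
  shows "orthogonal_matrix (vector [x, y, z, w] :: real^4^4)"
    "det (vector [x, y, z, w] :: real^4^4) = 1"
proof -
  let ?M = "vector [x, y, z, w] :: real^4^4"
  have "(?M ** transpose ?M) $ i $ j = ?M $ i \<bullet> ?M $ j" for i j
    by (simp add: matrix_matrix_mult_def transpose_def inner_vec_def)
  then have "?M ** transpose ?M = mat 1"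
    using assms unfolding pos_orthonormal_frame_def
    by (simp add: vec_eq_iff forall_4 mat_def inner_commute)
  then show o: "orthogonal_matrix ?M"
    by (metis orthogonal_matrix orthogonal_matrix_transpose transpose_transpose)
  show "det ?M = 1"
    using det_orthogonal_matrix[OF o] assms unfolding pos_orthonormal_frame_def by auto
qed

lemma pos_orthonormal_frame_inner:
  assumes "pos_orthonormal_frame t x y z"
  shows "t \<bullet> t = 1" "x \<bullet> x = 1" "y \<bullet> y = 1" "z \<bullet> z = 1"
    "t \<bullet> x = 0" "t \<bullet> y = 0" "t \<bullet> z = 0" "x \<bullet> y = 0" "x \<bullet> z = 0" "y \<bullet> z = 0"
    "x \<bullet> t = 0" "y \<bullet> t = 0" "z \<bullet> t = 0" "y \<bullet> x = 0" "z \<bullet> x = 0" "z \<bullet> y = 0"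
  using assms by (auto simp: pos_orthonormal_frame_def inner_commute)

text \<open>The entries of \<open>?M *v u\<close> are the frame coordinates of \<open>u\<close>, and
  the orthogonal matrix \<open>?M\<close> is injective.\<close>

lemma pos_orthonormal_frame_eqI:
  assumes "pos_orthonormal_frame x y z w"
    and "x \<bullet> u = x \<bullet> v" "y \<bullet> u = y \<bullet> v" "z \<bullet> u = z \<bullet> v" "w \<bullet> u = w \<bullet> v"
  shows "u = v"
proof -
  let ?M = "vector [x, y, z, w] :: real^4^4"
  have "transpose ?M ** ?M = mat 1"
    using orthogonal_matrix_frame(1)[OF assms(1)] by (simp add: orthogonal_matrix)
  then have inv: "transpose ?M *v (?M *v q) = q" for q
    by (simp only: matrix_vector_mul_assoc matrix_vector_mul_lid)
  have "?M *v u = ?M *v v" using assms by (simp only: matrix_vector_mult_vector_4)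
  then show ?thesis by (metis (no_types) inv)
qed

text \<open>With \<open>t\<close> as first factor, the product is the negative of the cross product
  of the \<open>x\<close>, \<open>y\<close>, \<open>z\<close> coordinates of the other two. The
  coefficient \<open>g\<close> drops out because \<open>t\<close> already occurs as a row.\<close>

lemma ternary_product_frame:
  assumes F: "pos_orthonormal_frame t x y z"
  shows "ternary_product t (a *\<^sub>R x + b *\<^sub>R y + c *\<^sub>R z) (d *\<^sub>R x + e *\<^sub>R y + f *\<^sub>R z + g *\<^sub>R t)
    = (c * e - b * f) *\<^sub>R x + (a * f - c * d) *\<^sub>R y + (b * d - a * e) *\<^sub>R z"
    (is "ternary_product t ?u ?v = ?w")
proof -
  let ?M = "vector [t, x, y, z] :: real^4^4"
  \<comment> \<open>Multiplication by \<open>transpose ?M\<close>, of determinant 1, replaces all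
    rows by their frame coordinates without changing the determinant.\<close>
  have D: "q \<bullet> ternary_product t ?u ?v = det (vector [?M *v q, ?M *v t, ?M *v ?u, ?M *v ?v] :: real^4^4)"
    for q
  proof -
    let ?A = "vector [q, t, ?u, ?v] :: real^4^4"
    have "?A ** transpose ?M = vector [?M *v q, ?M *v t, ?M *v ?u, ?M *v ?v]"
      by (simp only: vec_eq_iff forall_4)
        (simp add: matrix_matrix_mult_def transpose_def matrix_vector_mult_def mult.commute)
    then show ?thesis
      using det_mul[of ?A "transpose ?M"] orthogonal_matrix_frame(2)[OF F]
      by (simp add: inner_ternary_product)
  qed
  show ?thesis
    by (rule pos_orthonormal_frame_eqI[OF F];
      simp only: D matrix_vector_mult_vector_4 inner_add_right inner_scaleR_right
        pos_orthonormal_frame_inner[OF F];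
      simp add: det_4)
qed

subsection \<open>The soliton surface\<close>

text \<open>The target space is left general so that the rule serves both for vector fields expanded
  in the frame and, over the reals, for the scalar products of \<open>k\<close> and
  \<open>n\<close>.\<close>

lemma pd_scaleR_sum3:
  fixes x y z :: "real \<times> real \<Rightarrow> 'b::real_normed_vector"
  assumes "a differentiable (at p)" "b differentiable (at p)" "c differentiable (at p)"
    "x differentiable (at p)" "y differentiable (at p)" "z differentiable (at p)"
  shows "pd_s (\<lambda>q. a q *\<^sub>R x q + b q *\<^sub>R y q + c q *\<^sub>R z q) p
      = pd_s a p *\<^sub>R x p + pd_s b p *\<^sub>R y p + pd_s c p *\<^sub>R z p
        + a p *\<^sub>R pd_s x p + b p *\<^sub>R pd_s y p + c p *\<^sub>R pd_s z p"
    and "pd_t (\<lambda>q. a q *\<^sub>R x q + b q *\<^sub>R y q + c q *\<^sub>R z q) p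
      = pd_t a p *\<^sub>R x p + pd_t b p *\<^sub>R y p + pd_t c p *\<^sub>R z p
        + a p *\<^sub>R pd_t x p + b p *\<^sub>R pd_t y p + c p *\<^sub>R pd_t z p"
proof -
  note d = has_derivative_add[OF has_derivative_add[OF
    has_derivative_scaleR[OF has_derivative_pd[OF assms(1)] has_derivative_pd[OF assms(4)]]
    has_derivative_scaleR[OF has_derivative_pd[OF assms(2)] has_derivative_pd[OF assms(5)]]]
    has_derivative_scaleR[OF has_derivative_pd[OF assms(3)] has_derivative_pd[OF assms(6)]]]
  show "pd_s (\<lambda>q. a q *\<^sub>R x q + b q *\<^sub>R y q + c q *\<^sub>R z q) p
      = pd_s a p *\<^sub>R x p + pd_s b p *\<^sub>R y p + pd_s c p *\<^sub>R z p
        + a p *\<^sub>R pd_s x p + b p *\<^sub>R pd_s y p + c p *\<^sub>R pd_s z p"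
    using pd_eqI(1)[OF d] by simp
  show "pd_t (\<lambda>q. a q *\<^sub>R x q + b q *\<^sub>R y q + c q *\<^sub>R z q) p
      = pd_t a p *\<^sub>R x p + pd_t b p *\<^sub>R y p + pd_t c p *\<^sub>R z p
        + a p *\<^sub>R pd_t x p + b p *\<^sub>R pd_t y p + c p *\<^sub>R pd_t z p"
    using pd_eqI(2)[OF d] by simp
qed

text \<open>Differentiating the orthonormality relations in this way yields the skew symmetry of the
  coefficients of the \<open>t\<close>-derivatives of the frame.\<close>

lemma pd_t_inner_const:
  assumes "open D" "p \<in> D" "x differentiable (at p)" "y differentiable (at p)"
    and "\<And>q. q \<in> D \<Longrightarrow> x q \<bullet> y q = c"
  shows "pd_t x p \<bullet> y p + x p \<bullet> pd_t y p = 0"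
proof -
  note d = has_derivative_inner[OF has_derivative_pd[OF assms(3)] has_derivative_pd[OF assms(4)]]
  have "pd_t (\<lambda>q. x q \<bullet> y q) p = pd_t (\<lambda>q. c) p"
    using assms(1,2,5) d by (intro pd_cong) (auto simp: differentiable_def)
  also have "\<dots> = 0" by (simp add: pd_t_def)
  finally show ?thesis using pd_eqI(2)[OF d] by (simp add: add.commute)
qed

theorem theorem8:
  fixes I J :: "real set"
    and \<Psi> T P1 P2 P3 :: "real \<times> real \<Rightarrow> real^4"
    and D :: "(real \<times> real) set"
    and k1 k2 k3 :: "real \<times> real \<Rightarrow> real"
  assumes "open I" "is_interval I" "I \<noteq> {}"
    and "open J" "is_interval J" "J \<noteq> {}"
    and "D = I \<times> J"
    and "smooth_map_on D \<Psi>"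
    and "\<forall>p\<in>D. norm (pd_s \<Psi> p) = 1"
    and "betchov_da_rios D \<Psi>"
    and "parallel_transport_frame D \<Psi> T P1 P2 P3 k1 k2 k3"
    and "(\<exists>p\<in>D. k1 p \<noteq> 0) \<and> (\<exists>p\<in>D. k2 p \<noteq> 0) \<or>
         (\<exists>p\<in>D. k1 p \<noteq> 0) \<and> (\<exists>p\<in>D. k3 p \<noteq> 0) \<or>
         (\<exists>p\<in>D. k2 p \<noteq> 0) \<and> (\<exists>p\<in>D. k3 p \<noteq> 0)"
    and "\<forall>p\<in>D. \<not> (curv_P k1 k2 k3 p = 0 \<and> curv_R k1 k2 k3 p = 0 \<and> curv_S k1 k2 k3 p = 0)"
  shows "semi_umbilic D \<Psi> (normal_N1 P1 P2 P3 k1 k2 k3) (normal_N2 P1 P2 P3 k1 k2 k3) \<longleftrightarrow>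
    (\<forall>p\<in>D. (curv_Q k1 k2 k3 p * curv_W k1 k2 k3 p)\<^sup>2 = curv_A P1 P2 P3 k1 k2 k3 p
            \<or> curv_C k1 k2 k3 p = 0)"
proof -
  define P where "P = curv_P k1 k2 k3"
  define R where "R = curv_R k1 k2 k3"
  define S where "S = curv_S k1 k2 k3"
  have D: "open D" using assms by (simp add: open_Times)
  note frame = assms(11)[unfolded parallel_transport_frame_def]
  have smooth: "smooth_map_on D T" "smooth_map_on D P1" "smooth_map_on D P2" "smooth_map_on D P3"
    and F: "\<And>p. p \<in> D \<Longrightarrow> pos_orthonormal_frame (T p) (P1 p) (P2 p) (P3 p)"
    and T': "\<And>p. p \<in> D \<Longrightarrow> T p = pd_s \<Psi> p"
    and T_s: "\<And>p. p \<in> D \<Longrightarrow> pd_s T p = k1 p *\<^sub>R P1 p + k2 p *\<^sub>R P2 p + k3 p *\<^sub>R P3 p"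
    and P_s: "\<And>p. p \<in> D \<Longrightarrow> pd_s P1 p = - (k1 p *\<^sub>R T p)" "\<And>p. p \<in> D \<Longrightarrow> pd_s P2 p = - (k2 p *\<^sub>R T p)"
      "\<And>p. p \<in> D \<Longrightarrow> pd_s P3 p = - (k3 p *\<^sub>R T p)"
    using frame by blast+
  note T = T'[symmetric]
  note ip = pos_orthonormal_frame_inner[OF F]
  note smooth_pd = smooth_map_on_pd[OF D]
  \<comment> \<open>Smoothness of the curvature functions is inherited from the frame, since
    \<open>k1\<close>, \<open>k2\<close>, \<open>k3\<close> are the inner products of
    \<open>pd_s T\<close> with \<open>P1\<close>, \<open>P2\<close>, \<open>P3\<close> on
    \<open>D\<close>.\<close>
  have T_s_P: "smooth_map_on D (\<lambda>p. pd_s T p \<bullet> P1 p)" "smooth_map_on D (\<lambda>p. pd_s T p \<bullet> P2 p)"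
    "smooth_map_on D (\<lambda>p. pd_s T p \<bullet> P3 p)"
    by (intro smooth_map_on_inner D smooth_pd smooth)+
  have smooth_k: "smooth_map_on D k1" "smooth_map_on D k2" "smooth_map_on D k3"
    using smooth_map_on_cong[OF D _ T_s_P(1), of k1] smooth_map_on_cong[OF D _ T_s_P(2), of k2]
      smooth_map_on_cong[OF D _ T_s_P(3), of k3]
    by (simp_all add: T_s ip inner_add_left)
  have smooth_n: "smooth_map_on D P" "smooth_map_on D R" "smooth_map_on D S"
    unfolding P_def R_def S_def curv_P_def curv_R_def curv_S_def
    by (intro smooth_map_on_diff smooth_map_on_mult D smooth_k smooth_pd)+
  note diff = smooth_map_on_imp_differentiable
  note diffs = smooth[THEN diff] smooth_k[THEN diff] smooth_n[THEN diff]
  have \<Psi>_ss: "pd_s (pd_s \<Psi>) p = k1 p *\<^sub>R P1 p + k2 p *\<^sub>R P2 p + k3 p *\<^sub>R P3 p" if "p \<in> D" for p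
    using pd_cong(1)[OF D that, of T "pd_s \<Psi>"] T T_s diffs that by simp
  have \<Psi>_sss: "pd_s (pd_s (pd_s \<Psi>)) p = pd_s k1 p *\<^sub>R P1 p + pd_s k2 p *\<^sub>R P2 p + pd_s k3 p *\<^sub>R P3 p
      + (- ((k1 p)\<^sup>2 + (k2 p)\<^sup>2 + (k3 p)\<^sup>2)) *\<^sub>R T p" if "p \<in> D" for p
  proof -
    have "pd_s (pd_s (pd_s \<Psi>)) p = pd_s (\<lambda>p. k1 p *\<^sub>R P1 p + k2 p *\<^sub>R P2 p + k3 p *\<^sub>R P3 p) p"
      using assms(8) that by (intro pd_cong[OF D that] \<Psi>_ss diff[OF smooth_pd(1)] smooth_pd)
    also have "\<dots> = pd_s k1 p *\<^sub>R P1 p + pd_s k2 p *\<^sub>R P2 p + pd_s k3 p *\<^sub>R P3 p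
      + (- ((k1 p)\<^sup>2 + (k2 p)\<^sup>2 + (k3 p)\<^sup>2)) *\<^sub>R T p"
      by (simp add: pd_scaleR_sum3 diffs P_s that) (simp add: algebra_simps power2_eq_square)
    finally show ?thesis .
  qed
  \<comment> \<open>The tangential part of the third derivative does not contribute to the product.
    Removing \<open>scaleR_minus_left\<close> keeps its negative coefficient in the shape that
    \<open>ternary_product_frame\<close> matches.\<close>
  have \<Psi>_t: "pd_t \<Psi> p = P p *\<^sub>R P1 p + R p *\<^sub>R P2 p + S p *\<^sub>R P3 p" if "p \<in> D" for p
    using assms(10) that
    by (simp add: betchov_da_rios_def T \<Psi>_ss \<Psi>_sss del: scaleR_minus_left)
      (simp add: ternary_product_frame[OF F] P_def R_def S_def curv_P_def curv_R_def curv_S_def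
        del: scaleR_minus_left)
  have "gaussian_torsion \<Psi> (normal_N1 P1 P2 P3 k1 k2 k3) (normal_N2 P1 P2 P3 k1 k2 k3) p = 0 \<longleftrightarrow>
    (curv_Q k1 k2 k3 p * curv_W k1 k2 k3 p)\<^sup>2 = curv_A P1 P2 P3 k1 k2 k3 p \<or> curv_C k1 k2 k3 p = 0"
    if p: "p \<in> D" for p
  proof -
    define Q where "Q = curv_Q k1 k2 k3 p"
    define W where "W = curv_W k1 k2 k3 p"
    define A where "A = curv_A P1 P2 P3 k1 k2 k3 p"
    define C where "C = curv_C k1 k2 k3 p"
    define N1 where "N1 = normal_N1 P1 P2 P3 k1 k2 k3 p"
    define N2 where "N2 = normal_N2 P1 P2 P3 k1 k2 k3 p"
    note dp = diffs[OF p] and ipp = ip[OF p]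
    have n: "P p = k3 p * pd_s k2 p - k2 p * pd_s k3 p"
      "R p = k1 p * pd_s k3 p - k3 p * pd_s k1 p" "S p = k2 p * pd_s k1 p - k1 p * pd_s k2 p"
      by (simp_all add: P_def R_def S_def curv_P_def curv_R_def curv_S_def)
    have Q2: "Q\<^sup>2 = (k1 p)\<^sup>2 + (k2 p)\<^sup>2 + (k3 p)\<^sup>2" by (simp add: Q_def curv_Q_def)
    have W2: "W\<^sup>2 = (P p)\<^sup>2 + (R p)\<^sup>2 + (S p)\<^sup>2"
      by (simp add: W_def curv_W_def P_def R_def S_def)
    have nz: "P p \<noteq> 0 \<or> R p \<noteq> 0 \<or> S p \<noteq> 0" using assms(13) p by (auto simp: P_def R_def S_def)
    then have "W\<^sup>2 \<noteq> 0" unfolding W2 by (auto simp: add_nonneg_eq_0_iff)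
    \<comment> \<open>If \<open>k\<close> vanished at \<open>p\<close>, so would \<open>P\<close>,
      \<open>R\<close> and \<open>S\<close>, each of which is linear in \<open>k\<close>.\<close>
    moreover have "Q\<^sup>2 \<noteq> 0" using nz unfolding Q2 n by (auto simp: add_nonneg_eq_0_iff)
    ultimately have QW: "Q > 0" "W > 0"
      using real_sqrt_ge_zero by (auto simp: Q_def W_def curv_Q_def curv_W_def less_le)

    \<comment> \<open>Here \<open>n\<close> is orthogonal to \<open>k\<close> at every
      \<open>q\<close>, so the function differentiated below is constantly zero. Writing the real
      products with \<open>scaleR\<close> makes \<open>pd_scaleR_sum3\<close> applicable.\<close>
    have orth: "P q *\<^sub>R k1 q + R q *\<^sub>R k2 q + S q *\<^sub>R k3 q = 0" for q
      by (simp add: P_def R_def S_def curv_P_def curv_R_def curv_S_def algebra_simps)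
    have "pd_s (\<lambda>q. P q *\<^sub>R k1 q + R q *\<^sub>R k2 q + S q *\<^sub>R k3 q) p = 0"
      unfolding orth by (simp add: pd_s_def)
    \<comment> \<open>The other half of the product rule is the inner product of \<open>n\<close>
      and \<open>pd_s k\<close>, which also vanishes as \<open>n\<close> is a multiple of their
      cross product.\<close>
    then have orth_s: "k1 p * pd_s P p + k2 p * pd_s R p + k3 p * pd_s S p = 0"
      unfolding pd_scaleR_sum3(1)[OF dp(8-10) dp(5-7)] by (simp add: n algebra_simps)
    have "pd_t (\<lambda>q. P q *\<^sub>R k1 q + R q *\<^sub>R k2 q + S q *\<^sub>R k3 q) p = 0"
      unfolding orth by (simp add: pd_t_def)
    \<comment> \<open>No such cancellation occurs in direction \<open>t\<close>; the right side
      supplies the terms of \<open>curv_A\<close> that contain \<open>pd_t k1\<close>,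
      \<open>pd_t k2\<close>, \<open>pd_t k3\<close>.\<close>
    then have orth_t: "k1 p * pd_t P p + k2 p * pd_t R p + k3 p * pd_t S p
        = - (P p * pd_t k1 p + R p * pd_t k2 p + S p * pd_t k3 p)"
      unfolding pd_scaleR_sum3(2)[OF dp(8-10) dp(5-7)] by (simp add: algebra_simps)

    have anti: "pd_t P1 p \<bullet> P1 p = 0" "pd_t P2 p \<bullet> P2 p = 0" "pd_t P3 p \<bullet> P3 p = 0"
      "pd_t P2 p \<bullet> P1 p = - (pd_t P1 p \<bullet> P2 p)" "pd_t P3 p \<bullet> P1 p = - (pd_t P1 p \<bullet> P3 p)"
      "pd_t P3 p \<bullet> P2 p = - (pd_t P2 p \<bullet> P3 p)"
      using pd_t_inner_const[OF D p dp(2) dp(2), of 1] pd_t_inner_const[OF D p dp(3) dp(3), of 1]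
        pd_t_inner_const[OF D p dp(4) dp(4), of 1] pd_t_inner_const[OF D p dp(2) dp(3), of 0]
        pd_t_inner_const[OF D p dp(2) dp(4), of 0] pd_t_inner_const[OF D p dp(3) dp(4), of 0]
      by (simp_all add: ip inner_commute)

    \<comment> \<open>Exchanging the derivatives leaves only \<open>s\<close>-derivatives of the
      frame, which are tangential; their total coefficient is minus the inner product of
      \<open>n\<close> and \<open>k\<close>, hence zero.\<close>
    have "pd_t (pd_s \<Psi>) p = pd_s (pd_t \<Psi>) p"
      by (rule pd_t_pd_s_eq_pd_s_pd_t[OF D assms(8) p])
    also have "\<dots> = pd_s (\<lambda>p. P p *\<^sub>R P1 p + R p *\<^sub>R P2 p + S p *\<^sub>R P3 p) p"
      using assms(8) p by (intro pd_cong[OF D p] \<Psi>_t diff[OF smooth_pd(2)])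
    also have "\<dots> = pd_s P p *\<^sub>R P1 p + pd_s R p *\<^sub>R P2 p + pd_s S p *\<^sub>R P3 p
        - (P p * k1 p + R p * k2 p + S p * k3 p) *\<^sub>R T p"
      by (simp add: pd_scaleR_sum3 dp P_s p) (simp add: algebra_simps)
    finally have \<Psi>_st: "pd_t (pd_s \<Psi>) p
        = pd_s P p *\<^sub>R P1 p + pd_s R p *\<^sub>R P2 p + pd_s S p *\<^sub>R P3 p"
      using orth[of p] by simp
    have "pd_t (pd_t \<Psi>) p = pd_t (\<lambda>p. P p *\<^sub>R P1 p + R p *\<^sub>R P2 p + S p *\<^sub>R P3 p) p"
      using assms(8) p by (intro pd_cong[OF D p] \<Psi>_t diff[OF smooth_pd(2)])
    also have "\<dots> = pd_t P p *\<^sub>R P1 p + pd_t R p *\<^sub>R P2 p + pd_t S p *\<^sub>R P3 p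
        + P p *\<^sub>R pd_t P1 p + R p *\<^sub>R pd_t P2 p + S p *\<^sub>R pd_t P3 p"
      by (rule pd_scaleR_sum3(2)) (rule dp)+
    finally have \<Psi>_tt: "pd_t (pd_t \<Psi>) p = \<dots>" .

    have N1: "N1 = (1 / Q) *\<^sub>R (k1 p *\<^sub>R P1 p + k2 p *\<^sub>R P2 p + k3 p *\<^sub>R P3 p)"
      by (simp add: N1_def normal_N1_def Q_def)
    have N2: "N2 = (1 / (Q * W)) *\<^sub>R ((k2 p * S p - k3 p * R p) *\<^sub>R P1 p
        + (k3 p * P p - k1 p * S p) *\<^sub>R P2 p + (k1 p * R p - k2 p * P p) *\<^sub>R P3 p)"
      by (simp add: N2_def normal_N2_def Let_def Q_def W_def P_def R_def S_def)
    have g: "pd_s \<Psi> p \<bullet> pd_s \<Psi> p = 1" "pd_s \<Psi> p \<bullet> pd_t \<Psi> p = 0" "pd_t \<Psi> p \<bullet> pd_t \<Psi> p = W\<^sup>2"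
      unfolding W2 by (simp_all add: T \<Psi>_t p ipp inner_add_left inner_add_right power2_eq_square)
    have "pd_s (pd_s \<Psi>) p \<bullet> N1 = Q\<^sup>2 / Q"
      unfolding \<Psi>_ss[OF p] N1 Q2
      by (simp add: ipp inner_add_left inner_add_right power2_eq_square)
    then have c11: "pd_s (pd_s \<Psi>) p \<bullet> N1 = Q" using QW by (simp add: power2_eq_square)
    have c11': "pd_s (pd_s \<Psi>) p \<bullet> N2 = 0"
      unfolding \<Psi>_ss[OF p] N2
      by (simp add: ipp inner_add_left inner_add_right) (simp add: algebra_simps)
    have "pd_t (pd_s \<Psi>) p \<bullet> N1 = (k1 p * pd_s P p + k2 p * pd_s R p + k3 p * pd_s S p) / Q"
      unfolding \<Psi>_st N1 by (simp add: ipp inner_add_left inner_add_right mult.commute)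
    then have c12: "pd_t (pd_s \<Psi>) p \<bullet> N1 = 0" by (simp add: orth_s)
    have "pd_t (pd_s \<Psi>) p \<bullet> N2 = (pd_s P p * (k2 p * S p - k3 p * R p)
        + pd_s R p * (k3 p * P p - k1 p * S p) + pd_s S p * (k1 p * R p - k2 p * P p)) / (Q * W)"
      unfolding \<Psi>_st N2 by (simp add: ipp inner_add_left inner_add_right)
    \<comment> \<open>The coefficients of \<open>N2\<close> form \<open>k \<times> n\<close>, so the
      triple product expansion applies; pairing it with \<open>pd_s n\<close> gives \<open>C\<close>
      and a multiple of the expression that \<open>orth_s\<close> makes zero.\<close>
    also have "pd_s P p * (k2 p * S p - k3 p * R p) + pd_s R p * (k3 p * P p - k1 p * S p)
          + pd_s S p * (k1 p * R p - k2 p * P p)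
        = Q\<^sup>2 * C - (k1 p * pd_s k1 p + k2 p * pd_s k2 p + k3 p * pd_s k3 p)
            * (k1 p * pd_s P p + k2 p * pd_s R p + k3 p * pd_s S p)"
      unfolding n Q2 C_def curv_C_def P_def[symmetric] R_def[symmetric] S_def[symmetric]
      by (simp add: algebra_simps power2_eq_square)
    also have "\<dots> / (Q * W) = Q * C / W"
      using QW by (simp add: orth_s power2_eq_square)
    finally have c12': "pd_t (pd_s \<Psi>) p \<bullet> N2 = Q * C / W" .
    \<comment> \<open>By \<open>anti\<close>, the nine pairings of the \<open>pd_t Pi\<close> with
      the \<open>Pj\<close> reduce to the three coefficients in \<open>curv_A\<close>.\<close>
    have "pd_t (pd_t \<Psi>) p \<bullet> N1 = ((k1 p * pd_t P p + k2 p * pd_t R p + k3 p * pd_t S p)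
        + (P p * k3 p - S p * k1 p) * (pd_t P1 p \<bullet> P3 p)
        + (P p * k2 p - R p * k1 p) * (pd_t P1 p \<bullet> P2 p)
        + (R p * k3 p - S p * k2 p) * (pd_t P2 p \<bullet> P3 p)) / Q"
      unfolding \<Psi>_tt N1
      by (simp add: ipp anti inner_add_left inner_add_right) (simp add: algebra_simps)
    then have c22: "pd_t (pd_t \<Psi>) p \<bullet> N1 = A / Q"
      unfolding orth_t A_def curv_A_def Let_def P_def[symmetric] R_def[symmetric] S_def[symmetric]
      by (simp add: algebra_simps)
    \<comment> \<open>The pairing of \<open>pd_t (pd_t \<Psi>)\<close> with \<open>N2\<close> occurs
      only next to \<open>g12\<close> or next to the \<open>N1\<close> part of the mixed derivative,
      both zero, so its value never enters.\<close>
    have "gaussian_torsion \<Psi> (normal_N1 P1 P2 P3 k1 k2 k3) (normal_N2 P1 P2 P3 k1 k2 k3) p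
        = (W\<^sup>2 * (Q * (Q * C / W)) - Q * C / W * (A / Q)) / W ^ 3"
      using QW unfolding gaussian_torsion_def Let_def N1_def[symmetric] N2_def[symmetric]
      by (simp add: g c11 c11' c12 c12' c22)
    also have "\<dots> = C * ((Q * W)\<^sup>2 - A) / W ^ 4"
      using QW by (simp add: field_simps power2_eq_square power3_eq_cube power4_eq_xxxx)
    finally show ?thesis
      using QW unfolding Q_def[symmetric] W_def[symmetric] A_def[symmetric] C_def[symmetric] by auto
  qed
  then show ?thesis unfolding semi_umbilic_def by simp
qed

end
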